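(* Let $(\widetilde\alpha_j)_{j=1}^m$ and $(\widetilde\beta_j)_{j=1}^m$ be positive numbers satisfying $$\widetilde\alpha_j<\widetilde\beta_j<\widetilde\alpha_{j+1},\quad j\in\{1,\dots,m-1\},\qquad \widetilde\alpha_m<\widetilde\beta_m<\infty.$$ Then one can choose the domains $F_j$, $B_j$ and the numbers $\eta_j$ ($j=1,\dots,m$) in such a way that $$\alpha_j=\widetilde\alpha_j,\qquad \beta_j=\widetilde\beta_j,\qquad j=1,\dots,m.$$
   Context: Let $n\ge 2$ and $m\ge 1$ be integers and $Y=(0,1)^n$. Write $x=(x',x^n)\in\mathbb{R}^n$ with $x'\in\mathbb{R}^{n-1}$. Admissible data. $D_j$ ($j=1,\dots,m$) are (bounded) connected Lipschitz domains in $\mathbb{R}^{n-1}$ with $0\in D_j$, and $\eta_j>0$. $F_j,B_j$ ($j=1,\dots,m$) are Lipschitz domains in $\mathbb{R}^n$ with $\overline{B_j}\subset F_j$, $\overline{F_j}\subset Y$, and $\overline{F_i}\cap\overline{F_j}=\emptyset$ for $i\ne j$, such that for each $j$ there are $z_j=(z_j',z_j^n)\in\mathbb{R}^n$ and positive numbers $h_j,d_j$ with $\{x: |x^n-z_j^n|<h_j/2,\ \|x'-z_j'\|\le d_j\}\subset F_j\setminus\overline{B_j}$, $\{x: x^n-z_j^n=h_j/2,\ \|x'-z_j'\|\le d_j\}\subset\partial F_j$, $\{x: x^n-z_j^n=-h_j/2,\ \|x'-z_j'\|\le d_j\}\subset\partial B_j$ (Euclidean norm on $\mathbb{R}^{n-1}$).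 Set $B_0=Y\setminus\overline{\bigcup_{j=1}^mF_j}$. Associated numbers. Set $$\alpha_j=\frac{\eta_j^{n-1}|D_j|}{h_j|B_j|},\qquad j=1,\dots,m,$$ where $|\cdot|$ is $n$-dimensional volume for $B_j$ and $B_0$ and $(n-1)$-dimensional volume for $D_j$. It is assumed that the $\alpha_j$ are pairwise distinct and numbered so that $\alpha_j<\alpha_{j+1}$ for $j=1,\dots,m-1$. Let $$F(\lambda)=1+\sum_{j=1}^m\frac{\alpha_j|B_j|}{|B_0|(\alpha_j-\lambda)}.$$ This function has exactly $m$ zeros, all real; they are denoted $\beta_1<\dots<\beta_m$ and satisfy $\alpha_j<\beta_j<\alpha_{j+1}$ for $j=1,\dots,m-1$ and $\alpha_m<\beta_m<\infty$. *)

theory Defs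
  imports "HOL-Analysis.Analysis"
begin

text \<open>
  Points \<open>(x', x\<^sup>n)\<close> of \<open>n\<close>-dimensional space are elements of \<open>(real ^ 'k) \<times> real\<close>, so that
  \<open>n = CARD('k) + 1\<close> is an arbitrary integer \<open>\<ge> 2\<close>; \<open>fst x\<close> is \<open>x'\<close> and \<open>snd x\<close> is the last
  coordinate. The norm and \<open>lborel\<close> on this product are the Euclidean norm and
  \<open>n\<close>-dimensional Lebesgue measure. The index \<open>j\<close> runs over \<open>{1..m}\<close>; values of the families
  at other indices are irrelevant.
\<close>

text \<open>
  Near each boundary point the set is the part of space below the graph of a Lipschitz
  function over the hyperplane orthogonal to some unit vector \<open>u\<close>; choosing \<open>u\<close> amounts to
  the usual rotation of the coordinate axes. No uniformity of \<open>r\<close> and \<open>L\<close> is demanded, since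
  the boundaries of all sets considered are compact.
\<close>
definition lipschitz_domain :: "'a::euclidean_space set \<Rightarrow> bool" where
  "lipschitz_domain S \<longleftrightarrow> open S \<and> connected S \<and> S \<noteq> {} \<and>
     (\<forall>p\<in>frontier S. \<exists>u r L g. norm u = 1 \<and> r > 0 \<and> L-lipschitz_on {y. y \<bullet> u = 0} g \<and>
        S \<inter> ball p r = {x \<in> ball p r. x \<bullet> u < g (x - (x \<bullet> u) *\<^sub>R u)})"

definition unit_cell :: "((real ^ 'k) \<times> real) set" where
  "unit_cell = box 0 One"

definition admissible_resonators ::
  "nat \<Rightarrow> (nat \<Rightarrow> ((real ^ 'k) \<times> real) set) \<Rightarrow> (nat \<Rightarrow> ((real ^ 'k) \<times> real) set) \<Rightarrow>
   (nat \<Rightarrow> (real ^ 'k) \<times> real) \<Rightarrow> (nat \<Rightarrow> real) \<Rightarrow> (nat \<Rightarrow> real) \<Rightarrow> bool" where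
  "admissible_resonators m F B z h d \<longleftrightarrow>
     (\<forall>j\<in>{1..m}. lipschitz_domain (F j) \<and> lipschitz_domain (B j) \<and>
        closure (B j) \<subseteq> F j \<and> closure (F j) \<subseteq> unit_cell \<and>
        h j > 0 \<and> d j > 0 \<and>
        {x. \<bar>snd x - snd (z j)\<bar> < h j / 2 \<and> norm (fst x - fst (z j)) \<le> d j}
          \<subseteq> F j - closure (B j) \<and>
        {x. snd x - snd (z j) = h j / 2 \<and> norm (fst x - fst (z j)) \<le> d j} \<subseteq> frontier (F j) \<and>
        {x. snd x - snd (z j) = - (h j / 2) \<and> norm (fst x - fst (z j)) \<le> d j}
          \<subseteq> frontier (B j)) \<and>
     (\<forall>i\<in>{1..m}. \<forall>j\<in>{1..m}. i \<noteq> j \<longrightarrow> closure (F i) \<inter> closure (F j) = {})"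

definition B\<^sub>0 :: "nat \<Rightarrow> (nat \<Rightarrow> ((real ^ 'k) \<times> real) set) \<Rightarrow> ((real ^ 'k) \<times> real) set" where
  "B\<^sub>0 m F = unit_cell - closure (\<Union>j\<in>{1..m}. F j)"

definition alpha ::
  "(nat \<Rightarrow> (real ^ 'k) set) \<Rightarrow> (nat \<Rightarrow> ((real ^ 'k) \<times> real) set) \<Rightarrow>
   (nat \<Rightarrow> real) \<Rightarrow> (nat \<Rightarrow> real) \<Rightarrow> nat \<Rightarrow> real" where
  "alpha D B \<eta> h j =
     \<eta> j ^ CARD('k) * measure lborel (D j) / (h j * measure lborel (B j))"

definition dispersion ::
  "nat \<Rightarrow> (nat \<Rightarrow> real) \<Rightarrow> (nat \<Rightarrow> ((real ^ 'k) \<times> real) set) \<Rightarrow>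
   (nat \<Rightarrow> ((real ^ 'k) \<times> real) set) \<Rightarrow> complex \<Rightarrow> complex" where
  "dispersion m \<alpha> F B \<zeta> =
     1 + (\<Sum>j=1..m. of_real (\<alpha> j * measure lborel (B j)) /
                     (of_real (measure lborel (B\<^sub>0 m F)) * (of_real (\<alpha> j) - \<zeta>)))"

text \<open>
  The poles \<open>\<alpha> j\<close> are not in the domain of the function and have to be excluded by hand,
  because \<open>x / 0 = 0\<close>.
\<close>
definition dispersion_zeros ::
  "nat \<Rightarrow> (nat \<Rightarrow> real) \<Rightarrow> (nat \<Rightarrow> ((real ^ 'k) \<times> real) set) \<Rightarrow>
   (nat \<Rightarrow> ((real ^ 'k) \<times> real) set) \<Rightarrow> complex set" where
  "dispersion_zeros m \<alpha> F B =
     {\<zeta>. \<zeta> \<notin> of_real ` \<alpha> ` {1..m} \<and> dispersion m \<alpha> F B \<zeta> = 0}"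

text \<open>
  \<open>\<beta> 1 < \<dots> < \<beta> m\<close> is the list of all complex zeros; this determines \<open>\<beta>\<close> on \<open>{1..m}\<close>.
\<close>
definition is_beta ::
  "nat \<Rightarrow> (nat \<Rightarrow> real) \<Rightarrow> (nat \<Rightarrow> ((real ^ 'k) \<times> real) set) \<Rightarrow>
   (nat \<Rightarrow> ((real ^ 'k) \<times> real) set) \<Rightarrow> (nat \<Rightarrow> real) \<Rightarrow> bool" where
  "is_beta m \<alpha> F B \<beta> \<longleftrightarrow>
     strict_mono_on {1..m} \<beta> \<and> of_real ` \<beta> ` {1..m} = dispersion_zeros m \<alpha> F B"

end

theory Submission imports Defs
begin

text \<open>
  The dispersion function is a rational function with value \<open>1\<close> at infinity and simple poles
  \<open>\<alpha> j\<close>. If its zeros are to be \<open>\<beta> j\<close>, it has to be \<open>\<Prod>j. (\<beta> j - \<zeta>) / (\<alpha> j - \<zeta>)\<close>, and the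
  partial fraction expansion of this product (\<open>prod_quotient_partial_fractions\<close>) prescribes
  the coefficients: \<open>\<alpha> j * |B j| / |B\<^sub>0|\<close> must equal
  \<open>c j = (\<beta> j - \<alpha> j) * (\<Prod>i\<noteq>j. (\<beta> i - \<alpha> j) / (\<alpha> i - \<alpha> j))\<close>. Interlacing is what makes every
  \<open>c j\<close> positive (\<open>interlacing_residue_pos\<close>). So the problem is reduced to geometry: find
  resonators whose volume ratios \<open>|B j| / |B\<^sub>0|\<close> are given positive numbers \<open>\<rho> j = c j / \<alpha> j\<close>.
  The radii \<open>\<eta> j\<close> enter only through \<open>\<alpha> j\<close>, to which they contribute a factor \<open>\<eta> j ^ (n - 1)\<close>;
  they can therefore be adjusted last to give the poles their values.

  Boxes suffice for the geometry. The unit cell is cut into \<open>m\<close> horizontal layers of equal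
  height. Inside layer \<open>j\<close>, \<open>F j\<close> is a copy of the layer shrunk about its centre, by the same
  factor for all \<open>j\<close>, and \<open>B j\<close> is a concentric smaller copy. The passage joins the centre of
  the top face of \<open>B j\<close> to the top face of \<open>F j\<close>. When the \<open>F j\<close> nearly fill the layers, \<open>|B\<^sub>0|\<close>
  is as small as desired, so that a box of volume \<open>\<rho> j * |B\<^sub>0|\<close> fits into \<open>F j\<close> however large
  \<open>\<rho> j\<close> is (\<open>stacked_boxes_with_volume_ratios\<close>). That boxes are Lipschitz domains is a special
  case of \<open>lipschitz_domain_polyhedron\<close>.
\<close>

section \<open>Partial fractions with interlacing zeros\<close>

text \<open>
  By induction on the set of poles: a new factor is \<open>1 + (b k - a k) / (a k - z)\<close>. Multiplying
  the old expansion by it and splitting the products of two simple fractions changes each old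
  coefficient by the factor \<open>(b k - a j) / (a k - a j)\<close>; the coefficient at the new pole is
  \<open>b k - a k\<close> times the old expansion evaluated at \<open>a k\<close>, that is, times the old product there.
\<close>
lemma prod_quotient_partial_fractions:
  fixes a b :: "'i \<Rightarrow> 'f::field"
  assumes "finite A" "inj_on a A" "z \<notin> a ` A"
  shows "(\<Prod>j\<in>A. (b j - z) / (a j - z)) =
         1 + (\<Sum>j\<in>A. (b j - a j) * (\<Prod>i\<in>A - {j}. (b i - a j) / (a i - a j)) / (a j - z))"
  using assms
proof (induction A arbitrary: z rule: finite_induct)
  case empty
  then show ?case by simp
next
  case (insert k A)
  define C where "C j = (b j - a j) * (\<Prod>i\<in>A - {j}. (b i - a j) / (a i - a j))" for j
  have inj: "inj_on a A" and ak: "a k \<notin> a ` A" and z: "z \<notin> a ` A" "a k \<noteq> z"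
    using insert.prems insert.hyps by auto
  have IH: "(\<Prod>j\<in>A. (b j - y) / (a j - y)) = 1 + (\<Sum>j\<in>A. C j / (a j - y))" if "y \<notin> a ` A" for y
    using insert.IH[OF inj that] by (simp add: C_def)
  have old: "(b j - a j) * (\<Prod>i\<in>insert k A - {j}. (b i - a j) / (a i - a j)) / (a j - z)
      = C j / (a j - z) + (b k - a k) / (a k - z) * (C j / (a j - z) - C j / (a j - a k))"
    if "j \<in> A" for j
  proof -
    define e s t where "e = b k - a k" and "s = a j - z" and "t = a k - z"
    have "a j \<noteq> a k" using that ak by (metis imageI)
    then have nz: "s \<noteq> 0" "t \<noteq> 0" "s - t \<noteq> 0" "t - s \<noteq> 0" using that z by (auto simp: s_def t_def)
    have "insert k A - {j} = insert k (A - {j})" using that insert.hyps by auto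
    then have "(b j - a j) * (\<Prod>i\<in>insert k A - {j}. (b i - a j) / (a i - a j))
        = C j * ((b k - a j) / (a k - a j))"
      using insert.hyps by (simp add: C_def)
    moreover have "(b k - a j) / (a k - a j) = 1 + e / (t - s)"
      using nz by (simp add: add_divide_eq_iff e_def s_def t_def) 
    moreover have "C j * (1 + e / (t - s)) / s = C j / s + e / t * (C j / s - C j / (s - t))"
    proof -
      have "C j / s - C j / (s - t) = C j / s + C j / (t - s)"
        by (metis minus_diff_eq divide_minus_right diff_minus_eq_add)
      also have "\<dots> = C j * t / (s * (t - s))"
        using nz by (simp add: add_frac_eq algebra_simps)
      finally have "e / t * (C j / s - C j / (s - t)) = C j * (e / (t - s)) / s"
        using nz by (simp add: mult_ac)
      then show ?thesis by (simp add: distrib_left add_divide_distrib)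
    qed
    ultimately show ?thesis by (simp add: e_def s_def t_def)
  qed
  have new: "(\<Prod>i\<in>insert k A - {k}. (b i - a k) / (a i - a k)) = 1 + (\<Sum>j\<in>A. C j / (a j - a k))"
    using IH[OF ak] insert.hyps by simp
  have expand: "(1 + r) * (1 + X) = 1 + (r * (1 + Y) + (X + r * (X - Y)))" for r X Y :: 'f
    by (simp add: ring_distribs)
  define r where "r = (b k - a k) / (a k - z)"
  have "(\<Prod>j\<in>insert k A. (b j - z) / (a j - z)) = (b k - z) / (a k - z) * (1 + (\<Sum>j\<in>A. C j / (a j - z)))"
    using IH[OF z(1)] insert.hyps by simp
  also have "(b k - z) / (a k - z) = 1 + r"
    using z(2) by (simp add: r_def add_divide_eq_iff)
  also have "(1 + r) * (1 + (\<Sum>j\<in>A. C j / (a j - z)))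
      = 1 + (r * (1 + (\<Sum>j\<in>A. C j / (a j - a k)))
          + ((\<Sum>j\<in>A. C j / (a j - z)) + r * ((\<Sum>j\<in>A. C j / (a j - z)) - (\<Sum>j\<in>A. C j / (a j - a k)))))"
    by (rule expand)
  also have "\<dots> = 1 + (r * (1 + (\<Sum>j\<in>A. C j / (a j - a k)))
          + (\<Sum>j\<in>A. C j / (a j - z) + r * (C j / (a j - z) - C j / (a j - a k))))"
    by (simp only: sum.distrib sum_subtractf flip: sum_distrib_left)
  also have "(\<Sum>j\<in>A. C j / (a j - z) + r * (C j / (a j - z) - C j / (a j - a k)))
      = (\<Sum>j\<in>A. (b j - a j) * (\<Prod>i\<in>insert k A - {j}. (b i - a j) / (a i - a j)) / (a j - z))"
    using old by (intro sum.cong refl) (simp only: r_def)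
  also have "r * (1 + (\<Sum>j\<in>A. C j / (a j - a k)))
      = (b k - a k) * (\<Prod>i\<in>insert k A - {k}. (b i - a k) / (a i - a k)) / (a k - z)"
    by (simp only: new r_def times_divide_eq_left)
  also have "1 + ((b k - a k) * (\<Prod>i\<in>insert k A - {k}. (b i - a k) / (a i - a k)) / (a k - z)
        + (\<Sum>j\<in>A. (b j - a j) * (\<Prod>i\<in>insert k A - {j}. (b i - a j) / (a i - a j)) / (a j - z)))
      = 1 + (\<Sum>j\<in>insert k A. (b j - a j) * (\<Prod>i\<in>insert k A - {j}. (b i - a j) / (a i - a j)) / (a j - z))"
    by (simp only: sum.insert[OF insert.hyps])
  finally show ?case .
qed

lemma interlacing_order:
  fixes a b :: "nat \<Rightarrow> real"
  assumes "\<And>j. j \<in> {1..m - 1} \<Longrightarrow> a j < b j \<and> b j < a (j + 1)"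
    and "a m < b m"
  shows "j \<in> {1..m} \<Longrightarrow> a j < b j"
    and "i \<in> {1..m} \<Longrightarrow> j \<in> {1..m} \<Longrightarrow> i < j \<Longrightarrow> b i < a j"
proof -
  have ab: "a j < b j" if "j \<in> {1..m}" for j
    using assms that by (cases "j = m") auto
  then show "j \<in> {1..m} \<Longrightarrow> a j < b j" .
  have mono: "a (Suc i) \<le> a j" if "Suc i \<le> j" "j \<le> m" "1 \<le> i" for i j
    using that
  proof (induction j rule: dec_induct)
    case base
    show ?case by simp
  next
    case (step j)
    then show ?case using assms(1)[of j] by fastforce
  qed
  show "i \<in> {1..m} \<Longrightarrow> j \<in> {1..m} \<Longrightarrow> i < j \<Longrightarrow> b i < a j"
    using assms(1)[of i] mono[of i j] by fastforce
qed

text \<open>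
  For \<open>i < j\<close> both \<open>b i\<close> and \<open>a i\<close> lie to the left of \<open>a j\<close>, for \<open>i > j\<close> both lie to the right,
  so each quotient is positive.
\<close>
lemma interlacing_residue_pos:
  fixes a b :: "nat \<Rightarrow> real"
  assumes ab: "\<And>j. j \<in> A \<Longrightarrow> a j < b j"
    and ba: "\<And>i j. i \<in> A \<Longrightarrow> j \<in> A \<Longrightarrow> i < j \<Longrightarrow> b i < a j"
    and j: "j \<in> A"
  shows "0 < (b j - a j) * (\<Prod>i\<in>A - {j}. (b i - a j) / (a i - a j))"
proof -
  have "0 < (b i - a j) / (a i - a j)" if "i \<in> A - {j}" for i
  proof (cases "i < j")
    case True
    then show ?thesis using ab[of i] ba[of i j] j that by (intro divide_neg_neg) auto
  next
    case False
    then have "j < i" using that by auto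
    then show ?thesis using ab[of i] ab[of j] ba[of j i] j that by (intro divide_pos_pos) auto
  qed
  then show ?thesis using ab[OF j] by (intro mult_pos_pos prod_pos) auto
qed

section \<open>Polyhedra are Lipschitz domains\<close>

lemma lipschitz_on_Min:
  fixes f :: "'i \<Rightarrow> 'a::metric_space \<Rightarrow> real"
  assumes "finite I" "I \<noteq> {}" and f: "\<And>i. i \<in> I \<Longrightarrow> L-lipschitz_on X (f i)"
  shows "L-lipschitz_on X (\<lambda>x. Min ((\<lambda>i. f i x) ` I))"
proof (rule lipschitz_onI)
  show "0 \<le> L" using assms lipschitz_on_nonneg by blast
  have le: "Min ((\<lambda>i. f i x) ` I) \<le> Min ((\<lambda>i. f i y) ` I) + L * dist x y" if "x \<in> X" "y \<in> X" for x y
  proof -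
    have "Min ((\<lambda>i. f i y) ` I) \<in> (\<lambda>i. f i y) ` I" using assms by (intro Min_in) auto
    then obtain i where i: "i \<in> I" "Min ((\<lambda>i. f i y) ` I) = f i y" by auto
    have "Min ((\<lambda>i. f i x) ` I) \<le> f i x" using assms i by (intro Min_le) auto
    also have "f i x \<le> f i y + L * dist x y"
      using lipschitz_onD[OF f[OF i(1)] that] by (auto simp: dist_real_def)
    finally show ?thesis using i by simp
  qed
  show "dist (Min ((\<lambda>i. f i x) ` I)) (Min ((\<lambda>i. f i y) ` I)) \<le> L * dist x y"
    if "x \<in> X" "y \<in> X" for x y
    using le[OF that] le[OF that(2,1)] unfolding dist_real_def dist_commute[of y x] by linarith
qed

text \<open>
  Near a boundary point \<open>p\<close> only the constraints that are tight at \<open>p\<close> matter. As \<open>u\<close> one can take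
  the direction from any point of the polyhedron to \<open>p\<close>: it makes an acute angle with every tight
  normal \<open>v i\<close>, so along \<open>u\<close> the tight constraint \<open>i\<close> is an upper bound for the height,
  affine in the foot point. The minimum of these bounds is the graph function.
\<close>
lemma lipschitz_domain_polyhedron:
  fixes v :: "'i \<Rightarrow> 'a::euclidean_space"
  assumes fin: "finite I" and S: "S = {x. \<forall>i\<in>I. x \<bullet> v i < c i}" and ne: "S \<noteq> {}"
  shows "lipschitz_domain S"
proof -
  have Int: "S = (\<Inter>i\<in>I. {x. v i \<bullet> x < c i})" by (auto simp: S inner_commute)
  have "open S" unfolding Int using fin by (intro open_INT) (auto intro: open_halfspace_lt)
  have "convex S" unfolding Int by (intro convex_INT) (auto intro: convex_halfspace_lt)
  have graph: "\<exists>u r L g. norm u = 1 \<and> r > 0 \<and> L-lipschitz_on {y. y \<bullet> u = 0} g \<and>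
        S \<inter> ball p r = {x \<in> ball p r. x \<bullet> u < g (x - (x \<bullet> u) *\<^sub>R u)}" if p: "p \<in> frontier S" for p
  proof -
    obtain q where q: "q \<in> S" using ne by blast
    have "p \<notin> S" "p \<in> closure S" using p \<open>open S\<close> by (auto simp: frontier_def interior_open)
    then have "p \<noteq> q" using q by blast
    have le: "p \<bullet> v i \<le> c i" if "i \<in> I" for i
    proof -
      have "closure S \<subseteq> {x. v i \<bullet> x \<le> c i}"
        using that by (intro closure_minimal closed_halfspace_le) (auto simp: S inner_commute less_imp_le)
      then show ?thesis using \<open>p \<in> closure S\<close> by (auto simp: inner_commute)
    qed
    define J where "J = {i \<in> I. p \<bullet> v i = c i}"
    have J: "finite J" "J \<noteq> {}"
      using fin \<open>p \<notin> S\<close> le by (auto simp: J_def S not_less intro: antisym)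
    define u where "u = sgn (p - q)"
    have u: "norm u = 1" using \<open>p \<noteq> q\<close> by (simp add: u_def norm_sgn)
    have pos: "0 < u \<bullet> v i" if "i \<in> J" for i
    proof -
      have "0 < (p - q) \<bullet> v i" using that q by (auto simp: J_def S inner_diff_left)
      then show ?thesis using \<open>p \<noteq> q\<close> by (simp add: u_def sgn_div_norm)
    qed
    define f where "f i y = (c i - y \<bullet> v i) / (u \<bullet> v i)" for i y
    define L where "L = (\<Sum>i\<in>J. norm (v i) / (u \<bullet> v i))"
    define g where "g y = Min ((\<lambda>i. f i y) ` J)" for y
    have "L-lipschitz_on {y. y \<bullet> u = 0} (f i)" if i: "i \<in> J" for i
    proof (rule lipschitz_onI)
      have nn: "0 \<le> norm (v i) / (u \<bullet> v i)" if "i \<in> J" for i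
        using pos[OF that] by simp
      then show "0 \<le> L" unfolding L_def by (rule sum_nonneg)
      have iL: "norm (v i) / (u \<bullet> v i) \<le> L"
        unfolding L_def using i nn J by (intro member_le_sum) auto
      fix x y
      have "dist (f i x) (f i y) = \<bar>(y - x) \<bullet> v i\<bar> / (u \<bullet> v i)"
        using pos[OF i] by (simp add: f_def dist_real_def inner_diff_left flip: diff_divide_distrib)
      also have "\<dots> \<le> norm (y - x) * norm (v i) / (u \<bullet> v i)"
        using pos[OF i] by (intro divide_right_mono Cauchy_Schwarz_ineq2) auto
      also have "\<dots> = norm (v i) / (u \<bullet> v i) * dist x y" by (simp add: dist_norm norm_minus_commute)
      also have "\<dots> \<le> L * dist x y" using iL by (intro mult_right_mono) auto
      finally show "dist (f i x) (f i y) \<le> L * dist x y" .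
    qed
    then have lip: "L-lipschitz_on {y. y \<bullet> u = 0} g"
      unfolding g_def using J by (intro lipschitz_on_Min)
    have "\<forall>\<^sub>F x in nhds p. \<forall>i\<in>I - J. x \<bullet> v i < c i"
    proof (intro eventually_ball_finite ballI)
      show "finite (I - J)" using fin by simp
      fix i assume "i \<in> I - J"
      then have "p \<bullet> v i < c i" using le[of i] by (auto simp: J_def)
      moreover have "((\<lambda>x. x \<bullet> v i) \<longlongrightarrow> p \<bullet> v i) (nhds p)"
        by (intro tendsto_intros filterlim_ident)
      ultimately show "\<forall>\<^sub>F x in nhds p. x \<bullet> v i < c i" by (rule order_tendstoD(2)[rotated])
    qed
    then obtain r where r: "r > 0" "\<And>x i. x \<in> ball p r \<Longrightarrow> i \<in> I - J \<Longrightarrow> x \<bullet> v i < c i"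
      unfolding eventually_nhds_metric by (auto simp: dist_commute)
    have "x \<in> S \<longleftrightarrow> x \<bullet> u < g (x - (x \<bullet> u) *\<^sub>R u)" if x: "x \<in> ball p r" for x
    proof -
      have "x \<in> S \<longleftrightarrow> (\<forall>i\<in>J. x \<bullet> v i < c i)"
        using r(2)[OF x] by (auto simp: S J_def)
      also have "\<dots> \<longleftrightarrow> (\<forall>i\<in>J. x \<bullet> u < f i (x - (x \<bullet> u) *\<^sub>R u))"
      proof (intro ball_cong refl)
        fix i assume "i \<in> J"
        then show "(x \<bullet> v i < c i) = (x \<bullet> u < f i (x - (x \<bullet> u) *\<^sub>R u))"
          using pos[of i] by (simp add: f_def inner_diff_left pos_less_divide_eq)
      qed
      also have "\<dots> \<longleftrightarrow> x \<bullet> u < g (x - (x \<bullet> u) *\<^sub>R u)"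
        unfolding g_def using J by (subst Min_gr_iff) auto
      finally show ?thesis .
    qed
    then have "S \<inter> ball p r = {x \<in> ball p r. x \<bullet> u < g (x - (x \<bullet> u) *\<^sub>R u)}" by auto
    then show ?thesis using u r(1) lip by blast
  qed
  show ?thesis
    unfolding lipschitz_domain_def
    using \<open>open S\<close> convex_connected[OF \<open>convex S\<close>] ne graph by blast
qed

lemma lipschitz_domain_box:
  fixes a b :: "'a::euclidean_space"
  assumes "box a b \<noteq> {}"
  shows "lipschitz_domain (box a b)"
proof (rule lipschitz_domain_polyhedron)
  show "finite (Basis \<union> uminus ` Basis :: 'a set)" by simp
  show "box a b \<noteq> {}" by fact
  have "- i \<notin> Basis" if "i \<in> Basis" for i :: 'a
  proof
    assume "- i \<in> Basis"
    then have "i \<bullet> (- i) = (if i = - i then 1 else 0)" using that by (simp only: inner_Basis)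
    moreover have "i \<bullet> (- i) = -1" using that by (simp add: inner_minus_right)
    ultimately show False by (simp split: if_splits)
  qed
  then show "box a b = {x. \<forall>e\<in>Basis \<union> uminus ` Basis. x \<bullet> e < (if e \<in> Basis then b \<bullet> e else a \<bullet> e)}"
    by (auto simp: mem_box ball_Un)
qed

section \<open>Stacked boxes in the unit cell\<close>

lemma mem_box_prod_cart:
  fixes a b :: "real ^ 'k"
  shows "x \<in> box (a, c) (b, d) \<longleftrightarrow>
    (\<forall>i. a $ i < fst x $ i \<and> fst x $ i < b $ i) \<and> c < snd x \<and> snd x < (d :: real)"
proof -
  have "x \<in> box (a, c) (b, d) \<longleftrightarrow> fst x \<in> box a b \<and> snd x \<in> box c d"
    by (cases x) (auto simp: mem_box Basis_prod_def ball_Un)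
  then show ?thesis by (simp add: mem_box_cart)
qed

lemma mem_cbox_prod_cart:
  fixes a b :: "real ^ 'k"
  shows "x \<in> cbox (a, c) (b, d) \<longleftrightarrow>
    (\<forall>i. a $ i \<le> fst x $ i \<and> fst x $ i \<le> b $ i) \<and> c \<le> snd x \<and> snd x \<le> (d :: real)"
  by (cases x) (auto simp: cbox_Pair_eq mem_box_cart)

lemma mem_unit_cell:
  "x \<in> (unit_cell :: ((real ^ 'k) \<times> real) set) \<longleftrightarrow>
    (\<forall>i. 0 < fst x $ i \<and> fst x $ i < 1) \<and> 0 < snd x \<and> snd x < 1"
proof -
  have "(One :: (real ^ 'k) \<times> real) = (vec 1, 1)"
  proof (rule euclidean_eqI)
    fix i :: "(real ^ 'k) \<times> real"
    assume i: "i \<in> Basis"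
    then have "(vec 1, 1) \<bullet> i = 1" by (auto simp: Basis_prod_def Basis_vec_def inner_axis)
    then show "One \<bullet> i = (vec 1, 1) \<bullet> i" using i by simp
  qed
  then have cell: "(unit_cell :: ((real ^ 'k) \<times> real) set) = box (0, 0) (vec 1, 1)"
    by (simp add: unit_cell_def zero_prod_def)
  show ?thesis unfolding cell mem_box_prod_cart by simp
qed

lemma measure_unit_cell: "measure lborel (unit_cell :: ((real ^ 'k) \<times> real) set) = 1"
  unfolding unit_cell_def by (subst measure_lborel_box_eq) simp

text \<open>
  The affine map that carries the cube of centre \<open>(1/2, \<dots>, 1/2)\<close> and half-width \<open>1/2\<close> onto the
  \<open>j\<close>-th of \<open>m\<close> layers of the unit cell divides the last coordinate by \<open>m\<close>. This is the
  image of the concentric cube of half-width \<open>w\<close>, so that \<open>w = 1/2\<close> would be the whole layer.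
\<close>
definition stacked_box :: "nat \<Rightarrow> nat \<Rightarrow> real \<Rightarrow> ((real ^ 'k) \<times> real) set" where
  "stacked_box m j w =
     box (vec (1/2 - w), (real j - 1/2 - w) / real m) (vec (1/2 + w), (real j - 1/2 + w) / real m)"

lemma mem_stacked_box:
  assumes "m \<ge> 1"
  shows "x \<in> stacked_box m j w \<longleftrightarrow>
    (\<forall>i. \<bar>fst x $ i - 1/2\<bar> < w) \<and> \<bar>real m * snd x - (real j - 1/2)\<bar> < w"
  using assms unfolding stacked_box_def mem_box_prod_cart
  by (auto simp: abs_less_iff pos_divide_less_eq pos_less_divide_eq algebra_simps)

lemma stacked_box_nonempty:
  assumes "m \<ge> 1" "0 < w"
  shows "stacked_box m j w \<noteq> {}"
proof -
  have "(vec (1/2), (real j - 1/2) / real m) \<in> stacked_box m j w"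
    using assms by (simp add: mem_stacked_box)
  then show ?thesis by blast
qed

lemma closure_stacked_box:
  assumes "m \<ge> 1" "0 < w"
  shows "closure (stacked_box m j w) =
     cbox (vec (1/2 - w), (real j - 1/2 - w) / real m) (vec (1/2 + w), (real j - 1/2 + w) / real m)"
  using stacked_box_nonempty[OF assms, of j] unfolding stacked_box_def by (rule closure_box)

lemma mem_closure_stacked_box:
  assumes "m \<ge> 1" "0 < w"
  shows "x \<in> closure (stacked_box m j w) \<longleftrightarrow>
    (\<forall>i. \<bar>fst x $ i - 1/2\<bar> \<le> w) \<and> \<bar>real m * snd x - (real j - 1/2)\<bar> \<le> w"
  using assms unfolding closure_stacked_box[OF assms] mem_cbox_prod_cart
  by (auto simp: abs_le_iff pos_divide_le_eq pos_le_divide_eq algebra_simps)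

lemma frontier_stacked_box:
  "frontier (stacked_box m j w) = closure (stacked_box m j w) - stacked_box m j w"
  by (simp add: frontier_def interior_open stacked_box_def open_box)

lemma measure_closure_stacked_box:
  assumes "m \<ge> 1" "0 < w"
  shows "measure lborel (closure (stacked_box m j w :: ((real ^ 'k) \<times> real) set))
       = (2 * w) ^ Suc CARD('k) / real m"
proof -
  have "cbox (vec (1/2 - w)) (vec (1/2 + w) :: real ^ 'k) \<noteq> {}"
    using assms by (simp add: interval_ne_empty_cart)
  moreover have "(real j - 1/2 - w) / real m \<le> (real j - 1/2 + w) / real m"
    using assms by (intro divide_right_mono) auto
  ultimately show ?thesis
    using assms unfolding closure_stacked_box[OF assms] content_Pair
    by (simp add: content_cbox_if_cart flip: diff_divide_distrib)
qed

lemma measure_stacked_box: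
  assumes "m \<ge> 1" "0 < w"
  shows "measure lborel (stacked_box m j w :: ((real ^ 'k) \<times> real) set)
       = (2 * w) ^ Suc CARD('k) / real m"
  using measure_closure_stacked_box[OF assms, of j, where 'k = 'k, unfolded closure_stacked_box[OF assms]]
  by (simp only: stacked_box_def measure_lborel_box_eq measure_lborel_cbox_eq)

lemma closure_stacked_box_subset_unit_cell:
  assumes "0 < w" "w < 1/2" "j \<in> {1..m}"
  shows "closure (stacked_box m j w) \<subseteq> unit_cell"
proof
  fix x :: "(real ^ 'a) \<times> real"
  assume x: "x \<in> closure (stacked_box m j w)"
  have m: "m \<ge> 1" and j: "1 \<le> real j" "real j \<le> real m" using assms by auto
  have *: "\<bar>fst x $ i - 1/2\<bar> \<le> w" "\<bar>real m * snd x - (real j - 1/2)\<bar> \<le> w" for i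
    using x assms(1) m by (auto simp: mem_closure_stacked_box)
  have "0 < fst x $ i \<and> fst x $ i < 1" for i
    using *(1)[of i] assms(2) by linarith
  moreover have "0 < real m * snd x" "real m * snd x < real m * 1"
    using *(2) assms(2) j by linarith+
  then have "0 < snd x" "snd x < 1"
    using m by (simp add: zero_less_mult_iff, simp)
  ultimately show "x \<in> unit_cell" by (simp add: mem_unit_cell)
qed

lemma closure_stacked_box_disjoint:
  assumes "m \<ge> 1" "0 < w" "w < 1/2" "i \<noteq> j"
  shows "closure (stacked_box m i w) \<inter> closure (stacked_box m j w) = {}"
proof -
  have "1 \<le> \<bar>real i - real j\<bar>" using assms(4) by linarith
  have False if "x \<in> closure (stacked_box m i w)" "x \<in> closure (stacked_box m j w)"
    for x :: "(real ^ 'a) \<times> real"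
  proof -
    have "\<bar>real m * snd x - (real i - 1/2)\<bar> \<le> w" "\<bar>real m * snd x - (real j - 1/2)\<bar> \<le> w"
      using that assms by (auto simp: mem_closure_stacked_box)
    then show False using \<open>1 \<le> \<bar>real i - real j\<bar>\<close> assms(3) by linarith
  qed
  then show ?thesis by blast
qed

lemma closure_UN_finite:
  "finite A \<Longrightarrow> closure (\<Union>i\<in>A. S i) = (\<Union>i\<in>A. closure (S i))"
  by (induction rule: finite_induct) (simp_all add: closure_Un)

lemma measure_B\<^sub>0_stacked_box:
  assumes "m \<ge> 1" "0 < w" "w < 1/2"
  shows "measure lborel (B\<^sub>0 m (\<lambda>j. stacked_box m j w :: ((real ^ 'k) \<times> real) set))
       = 1 - (2 * w) ^ Suc CARD('k)"
proof -
  let ?C = "\<lambda>j. closure (stacked_box m j w :: ((real ^ 'k) \<times> real) set)"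
  have bounded: "bounded (?C j)" for j
    using assms by (simp add: closure_stacked_box bounded_cbox)
  have "closure (\<Union>j\<in>{1..m}. stacked_box m j w) = (\<Union>j\<in>{1..m}. ?C j)"
    by (rule closure_UN_finite) simp
  then have B: "B\<^sub>0 m (\<lambda>j. stacked_box m j w :: ((real ^ 'k) \<times> real) set) = unit_cell - (\<Union>j\<in>{1..m}. ?C j)"
    by (simp add: B\<^sub>0_def)
  have "measure lborel (\<Union>j\<in>{1..m}. ?C j) = (\<Sum>j\<in>{1..m}. measure lborel (?C j))"
  proof (rule measure_finite_Union)
    show "disjoint_family_on ?C {1..m}"
      using closure_stacked_box_disjoint[OF assms] by (auto simp: disjoint_family_on_def)
    show "emeasure lborel (?C j) \<noteq> \<infinity>" for j
      using emeasure_bounded_finite[OF bounded] by (simp add: less_top)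
  qed auto
  also have "\<dots> = (2 * w) ^ Suc CARD('k)"
    using assms by (simp add: measure_closure_stacked_box)
  finally have U: "measure lborel (\<Union>j\<in>{1..m}. ?C j) = (2 * w) ^ Suc CARD('k)" .
  have "measure lborel (unit_cell - (\<Union>j\<in>{1..m}. ?C j))
      = measure lborel (unit_cell :: ((real ^ 'k) \<times> real) set) - measure lborel (\<Union>j\<in>{1..m}. ?C j)"
  proof (rule measure_Diff)
    show "emeasure lborel (unit_cell :: ((real ^ 'k) \<times> real) set) \<noteq> \<infinity>"
      using emeasure_bounded_finite[OF bounded_box] by (simp add: less_top unit_cell_def)
    show "(\<Union>j\<in>{1..m}. ?C j) \<subseteq> unit_cell"
      using closure_stacked_box_subset_unit_cell assms by blast
  qed (auto simp: unit_cell_def)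
  then show ?thesis by (simp only: B U measure_unit_cell)
qed

text \<open>
  In the coordinate \<open>m * snd x - (j - 1/2)\<close>, which measures height from the middle of layer \<open>j\<close>
  in units of the layer height, the passage occupies the range from \<open>v j\<close> (top of the inner
  box) to \<open>w\<close> (top of the outer one). Its radius \<open>v j\<close> is the largest for which the
  bottom disc stays on the top face of the inner box.
\<close>
lemma admissible_stacked_boxes:
  assumes m: "m \<ge> 1" and w: "0 < w" "w < 1/2" and v: "\<And>j. j \<in> {1..m} \<Longrightarrow> 0 < v j \<and> v j < w"
  shows "admissible_resonators m
     (\<lambda>j. stacked_box m j w :: ((real ^ 'k) \<times> real) set) (\<lambda>j. stacked_box m j (v j))
     (\<lambda>j. (vec (1/2), (real j - 1/2 + (w + v j) / 2) / real m)) (\<lambda>j. (w - v j) / real m) v"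
proof -
  have one: "lipschitz_domain F \<and> lipschitz_domain B \<and> closure B \<subseteq> F \<and> closure F \<subseteq> unit_cell \<and>
        h > 0 \<and> d > 0 \<and>
        {x. \<bar>snd x - snd z\<bar> < h / 2 \<and> norm (fst x - fst z) \<le> d} \<subseteq> F - closure B \<and>
        {x. snd x - snd z = h / 2 \<and> norm (fst x - fst z) \<le> d} \<subseteq> frontier F \<and>
        {x. snd x - snd z = - (h / 2) \<and> norm (fst x - fst z) \<le> d} \<subseteq> frontier B"
    if j: "j \<in> {1..m}" and F: "F = stacked_box m j w" and B: "B = stacked_box m j (v j)"
      and z: "z = (vec (1/2), (real j - 1/2 + (w + v j) / 2) / real m)"
      and h: "h = (w - v j) / real m" and d: "d = v j"
    for j h d and F B :: "((real ^ 'k) \<times> real) set" and z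
  proof -
    have vw: "0 < v j" "v j < w" using v[OF j] by auto
    have hor: "\<bar>fst x $ i - 1/2\<bar> \<le> v j" if "norm (fst x - fst z) \<le> d" for x :: "(real ^ 'k) \<times> real" and i
      using component_le_norm_cart[of "fst x - fst z" i] that by (simp add: z d)
    have mh: "real m * h = w - v j" using m by (simp add: h)
    have mz: "real m * snd z = real j - 1/2 + (w + v j) / 2" using m by (simp add: z)
    have scale: "real m * (snd x - snd z) = real m * snd x - (real j - 1/2) - (w + v j) / 2"
      for x :: "(real ^ 'k) \<times> real"
      unfolding right_diff_distrib mz by simp
    have mid: "v j < real m * snd x - (real j - 1/2)" "real m * snd x - (real j - 1/2) < w"
      if "\<bar>snd x - snd z\<bar> < h / 2" for x :: "(real ^ 'k) \<times> real"
    proof -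
      have "real m * \<bar>snd x - snd z\<bar> < real m * (h / 2)"
        using that m by (intro mult_strict_left_mono) auto
      then have "\<bar>real m * (snd x - snd z)\<bar> < (real m * h) / 2" by (simp add: abs_mult)
      then show "v j < real m * snd x - (real j - 1/2)" "real m * snd x - (real j - 1/2) < w"
        unfolding scale mh abs_less_iff by argo+
    qed
    have top: "real m * snd x - (real j - 1/2) = w" if "snd x - snd z = h / 2" for x :: "(real ^ 'k) \<times> real"
    proof -
      have "real m * (snd x - snd z) = (real m * h) / 2" using that by simp
      then show ?thesis unfolding scale mh by argo
    qed
    have bot: "real m * snd x - (real j - 1/2) = v j" if "snd x - snd z = - (h / 2)" for x :: "(real ^ 'k) \<times> real"
    proof -
      have "real m * (snd x - snd z) = - ((real m * h) / 2)" using that by simp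
      then show ?thesis unfolding scale mh by argo
    qed
    have "lipschitz_domain F" "lipschitz_domain B"
      using stacked_box_nonempty m w vw unfolding F B stacked_box_def
      by (metis lipschitz_domain_box)+
    moreover have "closure B \<subseteq> F"
    proof
      fix x assume "x \<in> closure B"
      then show "x \<in> F"
        using vw m by (auto simp: F B mem_closure_stacked_box mem_stacked_box intro: le_less_trans)
    qed
    moreover have "closure F \<subseteq> unit_cell"
      unfolding F using w j by (rule closure_stacked_box_subset_unit_cell)
    moreover have "h > 0" "d > 0" using vw m by (auto simp: h d)
    moreover have "{x. \<bar>snd x - snd z\<bar> < h / 2 \<and> norm (fst x - fst z) \<le> d} \<subseteq> F - closure B"
    proof safe
      fix x1 x2 assume "\<bar>snd (x1, x2) - snd z\<bar> < h / 2" "norm (fst (x1, x2) - fst z) \<le> d"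
      note x = mid[OF this(1)] hor[OF this(2)]
      have "\<bar>fst (x1, x2) $ i - 1/2\<bar> < w" for i
        using x(3)[of i] vw(2) by linarith
      then show "(x1, x2) \<in> F"
        unfolding F mem_stacked_box[OF m] using x(1,2) vw by (auto simp: abs_less_iff)
      show False if "(x1, x2) \<in> closure B"
        using that x(1) vw m by (simp add: B mem_closure_stacked_box)
    qed
    moreover have "{x. snd x - snd z = h / 2 \<and> norm (fst x - fst z) \<le> d} \<subseteq> frontier F"
    proof
      fix x assume x: "x \<in> {x. snd x - snd z = h / 2 \<and> norm (fst x - fst z) \<le> d}"
      have "real m * snd x - (real j - 1/2) = w" "\<bar>fst x $ i - 1/2\<bar> \<le> w" for i
        using x top[of x] hor[of x i] vw by auto
      then show "x \<in> frontier F"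
        unfolding F frontier_stacked_box using w m by (simp add: mem_closure_stacked_box mem_stacked_box)
    qed
    moreover have "{x. snd x - snd z = - (h / 2) \<and> norm (fst x - fst z) \<le> d} \<subseteq> frontier B"
    proof
      fix x assume x: "x \<in> {x. snd x - snd z = - (h / 2) \<and> norm (fst x - fst z) \<le> d}"
      have "real m * snd x - (real j - 1/2) = v j" "\<bar>fst x $ i - 1/2\<bar> \<le> v j" for i
        using x bot[of x] hor[of x i] by auto
      then show "x \<in> frontier B"
        unfolding B frontier_stacked_box using vw m by (simp add: mem_closure_stacked_box mem_stacked_box)
    qed
    ultimately show ?thesis by blast
  qed
  show ?thesis
    unfolding admissible_resonators_def
    by (intro conjI[OF ballI ballI] ballI impI)
      (erule one[OF _ refl refl refl refl refl], erule closure_stacked_box_disjoint[OF m w])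
qed

lemma measure_lborel_open_pos:
  fixes S :: "'a::euclidean_space set"
  assumes "open S" "bounded S" "S \<noteq> {}"
  shows "0 < measure lborel S"
proof -
  have "\<not> negligible S" using assms open_not_negligible by blast
  moreover have "S \<in> lmeasurable" using assms by (simp add: lmeasurable_open)
  ultimately have "measure lebesgue S \<noteq> 0" by (simp add: negligible_iff_measure)
  then show ?thesis
    using assms(1) by (simp add: measure_completion zero_less_measure_iff)
qed

text \<open>
  If the outer boxes have total volume \<open>q\<close>, each has volume \<open>q / m\<close> and \<open>|B\<^sub>0| = 1 - q\<close>; hence inner
  boxes of volume \<open>\<rho> j * (1 - q)\<close> fit as soon as \<open>m * \<rho> j < q / (1 - q)\<close>. With
  \<open>q = R / (1 + R)\<close> the right-hand side is \<open>R\<close>, which only has to exceed all \<open>m * \<rho> j\<close>.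
\<close>
lemma stacked_boxes_with_volume_ratios:
  fixes \<rho> :: "nat \<Rightarrow> real"
  assumes m: "m \<ge> 1" and \<rho>: "\<And>j. j \<in> {1..m} \<Longrightarrow> 0 < \<rho> j"
  obtains w v where "0 < w" "w < 1/2" "\<And>j. j \<in> {1..m} \<Longrightarrow> 0 < v j \<and> v j < w"
    "0 < measure lborel (B\<^sub>0 m (\<lambda>j. stacked_box m j w :: ((real ^ 'k) \<times> real) set))"
    "\<And>j. j \<in> {1..m} \<Longrightarrow> measure lborel (stacked_box m j (v j) :: ((real ^ 'k) \<times> real) set)
       = \<rho> j * measure lborel (B\<^sub>0 m (\<lambda>j. stacked_box m j w :: ((real ^ 'k) \<times> real) set))"
proof -
  let ?n = "Suc CARD('k)"
  define R where "R = 1 + real m * (\<Sum>j\<in>{1..m}. \<rho> j)"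
  have sum0: "0 \<le> (\<Sum>j\<in>{1..m}. \<rho> j)" using \<rho> by (intro sum_nonneg) (auto intro: less_imp_le)
  then have R: "1 \<le> R" unfolding R_def by simp
  have \<rho>R: "real m * \<rho> j < R" if "j \<in> {1..m}" for j
  proof -
    have "\<rho> j \<le> (\<Sum>j\<in>{1..m}. \<rho> j)" using that \<rho> by (intro member_le_sum) (auto intro: less_imp_le)
    then have "real m * \<rho> j \<le> real m * (\<Sum>j\<in>{1..m}. \<rho> j)" by (intro mult_left_mono) auto
    then show ?thesis by (simp add: R_def)
  qed
  define w where "w = root ?n (R / (1 + R)) / 2"
  define v where "v j = root ?n (real m * \<rho> j / (1 + R)) / 2" for j
  have w_pow: "(2 * w) ^ ?n = R / (1 + R)"
    using R unfolding w_def by (simp del: power_Suc)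
  have v_pow: "(2 * v j) ^ ?n = real m * \<rho> j / (1 + R)" if "j \<in> {1..m}" for j
    using R \<rho>[OF that] unfolding v_def by (simp del: power_Suc)
  have w: "0 < w" "w < 1/2"
  proof -
    show "0 < w" using R by (simp add: w_def)
    have "root ?n (R / (1 + R)) < root ?n 1" using R by (intro real_root_less_mono) auto
    then show "w < 1/2" by (simp add: w_def)
  qed
  have v: "0 < v j \<and> v j < w" if "j \<in> {1..m}" for j
    using R m \<rho>[OF that] \<rho>R[OF that] unfolding v_def w_def by (auto simp: divide_strict_right_mono)
  have B0: "measure lborel (B\<^sub>0 m (\<lambda>j. stacked_box m j w :: ((real ^ 'k) \<times> real) set)) = 1 / (1 + R)"
    unfolding measure_B\<^sub>0_stacked_box[OF m w] w_pow using R by (simp add: field_simps)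
  show thesis
  proof (rule that[OF w v])
    show "0 < measure lborel (B\<^sub>0 m (\<lambda>j. stacked_box m j w :: ((real ^ 'k) \<times> real) set))"
      unfolding B0 using R by simp
    fix j assume j: "j \<in> {1..m}"
    have "measure lborel (stacked_box m j (v j) :: ((real ^ 'k) \<times> real) set) = (2 * v j) ^ ?n / real m"
      using m v[OF j] by (intro measure_stacked_box) auto
    then show "measure lborel (stacked_box m j (v j) :: ((real ^ 'k) \<times> real) set)
       = \<rho> j * measure lborel (B\<^sub>0 m (\<lambda>j. stacked_box m j w :: ((real ^ 'k) \<times> real) set))"
      unfolding B0 v_pow[OF j] using m by simp
  qed
qed

section \<open>Prescribing poles and zeros\<close>

text \<open>
  The volume condition says that the coefficients are those of the partial fraction expansion of
  \<open>\<Prod>j. (\<beta> j - \<zeta>) / (\<alpha> j - \<zeta>)\<close>, whose zeros can be read off; by interlacing none of the \<open>\<beta> j\<close> is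
  cancelled by a pole.
\<close>
lemma is_beta_of_interlacing:
  fixes \<alpha> \<beta> :: "nat \<Rightarrow> real" and F B :: "nat \<Rightarrow> ((real ^ 'k) \<times> real) set"
  assumes ab: "\<And>j. j \<in> {1..m} \<Longrightarrow> \<alpha> j < \<beta> j"
    and ba: "\<And>i j. i \<in> {1..m} \<Longrightarrow> j \<in> {1..m} \<Longrightarrow> i < j \<Longrightarrow> \<beta> i < \<alpha> j"
    and vol: "\<And>j. j \<in> {1..m} \<Longrightarrow> \<alpha> j * measure lborel (B j) = measure lborel (B\<^sub>0 m F) *
       ((\<beta> j - \<alpha> j) * (\<Prod>i\<in>{1..m} - {j}. (\<beta> i - \<alpha> j) / (\<alpha> i - \<alpha> j)))"
    and B0: "measure lborel (B\<^sub>0 m F) \<noteq> 0"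
  shows "is_beta m \<alpha> F B \<beta>"
proof -
  have sep: "\<alpha> i \<noteq> \<beta> j" if "i \<in> {1..m}" "j \<in> {1..m}" for i j
    using ab[OF that(1)] ab[OF that(2)] ba[OF that] ba[OF that(2,1)] by (cases i j rule: linorder_cases) auto
  have inj: "inj_on \<alpha> {1..m}"
  proof (rule linorder_inj_onI')
    fix i j assume "i \<in> {1..m}" "j \<in> {1..m}" "i < j"
    then show "\<alpha> i \<noteq> \<alpha> j" using ab[of i] ba[of i j] by auto
  qed
  have factor: "dispersion m \<alpha> F B z = (\<Prod>j=1..m. (of_real (\<beta> j) - z) / (of_real (\<alpha> j) - z))"
    if z: "z \<notin> of_real ` \<alpha> ` {1..m}" for z :: complex
  proof -
    have inj': "inj_on (\<lambda>j. complex_of_real (\<alpha> j)) {1..m}"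
      using inj unfolding inj_on_def of_real_eq_iff .
    have z': "z \<notin> (\<lambda>j. complex_of_real (\<alpha> j)) ` {1..m}"
      using z unfolding image_image .
    have "dispersion m \<alpha> F B z = 1 + (\<Sum>j=1..m.
        of_real ((\<beta> j - \<alpha> j) * (\<Prod>i\<in>{1..m} - {j}. (\<beta> i - \<alpha> j) / (\<alpha> i - \<alpha> j))) / (of_real (\<alpha> j) - z))"
      unfolding dispersion_def
    proof (intro arg_cong2[where f = "(+)"] sum.cong refl)
      fix j assume j: "j \<in> {1..m}"
      show "of_real (\<alpha> j * measure lborel (B j)) / (of_real (measure lborel (B\<^sub>0 m F)) * (of_real (\<alpha> j) - z))
        = of_real ((\<beta> j - \<alpha> j) * (\<Prod>i\<in>{1..m} - {j}. (\<beta> i - \<alpha> j) / (\<alpha> i - \<alpha> j))) / (of_real (\<alpha> j) - z)"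
        unfolding vol[OF j] of_real_mult[of "measure lborel (B\<^sub>0 m F)"]
        using B0 by (intro mult_divide_mult_cancel_left) simp
    qed
    then show ?thesis
      using prod_quotient_partial_fractions[OF finite_atLeastAtMost inj' z', of "\<lambda>j. of_real (\<beta> j)"]
      by (simp only: of_real_mult of_real_diff of_real_prod of_real_divide)
  qed
  have "dispersion_zeros m \<alpha> F B = of_real ` \<beta> ` {1..m}"
  proof (intro set_eqI iffI)
    fix z assume "z \<in> dispersion_zeros m \<alpha> F B"
    then have z: "z \<notin> of_real ` \<alpha> ` {1..m}" "dispersion m \<alpha> F B z = 0"
      by (auto simp: dispersion_zeros_def)
    then obtain j where j: "j \<in> {1..m}" "(of_real (\<beta> j) - z) / (of_real (\<alpha> j) - z) = 0"
      by (auto simp: factor)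
    then have "z = of_real (\<beta> j)" using z(1) by auto
    then show "z \<in> of_real ` \<beta> ` {1..m}" using j(1) by auto
  next
    fix z :: complex assume "z \<in> of_real ` \<beta> ` {1..m}"
    then obtain j where j: "j \<in> {1..m}" "z = of_real (\<beta> j)" by auto
    have z: "z \<notin> of_real ` \<alpha> ` {1..m}"
      using sep[OF _ j(1)] unfolding j(2) by (metis imageE of_real_eq_iff)
    moreover have "dispersion m \<alpha> F B z = 0"
      unfolding factor[OF z] using j by (intro prod_zero) auto
    ultimately show "z \<in> dispersion_zeros m \<alpha> F B" by (simp add: dispersion_zeros_def)
  qed
  moreover have "strict_mono_on {1..m} \<beta>"
  proof (rule strict_mono_onI)
    fix i j assume "i \<in> {1..m}" "j \<in> {1..m}" "i < j"
    then show "\<beta> i < \<beta> j" using ab[of j] ba[of i j] by auto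
  qed
  ultimately show ?thesis by (simp add: is_beta_def)
qed

theorem theorem2p2:
  fixes m :: nat
    and D :: "nat \<Rightarrow> (real ^ 'k) set"
    and \<alpha>' \<beta>' :: "nat \<Rightarrow> real"
  assumes "m \<ge> 1"
    and "\<And>j. j \<in> {1..m} \<Longrightarrow> bounded (D j) \<and> lipschitz_domain (D j) \<and> 0 \<in> D j"
    and "\<And>j. j \<in> {1..m} \<Longrightarrow> \<alpha>' j > 0 \<and> \<beta>' j > 0"
    and "\<And>j. j \<in> {1..m - 1} \<Longrightarrow> \<alpha>' j < \<beta>' j \<and> \<beta>' j < \<alpha>' (j + 1)"
    and "\<alpha>' m < \<beta>' m"
  shows "\<exists>(F :: nat \<Rightarrow> ((real ^ 'k) \<times> real) set) B \<eta> z h d \<beta>.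
           admissible_resonators m F B z h d \<and>
           (\<forall>j\<in>{1..m}. \<eta> j > 0) \<and>
           strict_mono_on {1..m} (alpha D B \<eta> h) \<and>
           is_beta m (alpha D B \<eta> h) F B \<beta> \<and>
           (\<forall>j\<in>{1..m}. alpha D B \<eta> h j = \<alpha>' j \<and> \<beta> j = \<beta>' j)"
proof -
  let ?c = "\<lambda>j. (\<beta>' j - \<alpha>' j) * (\<Prod>i\<in>{1..m} - {j}. (\<beta>' i - \<alpha>' j) / (\<alpha>' i - \<alpha>' j))"
  note ab = interlacing_order(1)[of m \<alpha>' \<beta>', OF assms(4,5)]
  note ba = interlacing_order(2)[of m \<alpha>' \<beta>', OF assms(4,5)]
  have "0 < ?c j / \<alpha>' j" if "j \<in> {1..m}" for j
    using interlacing_residue_pos[of "{1..m}" \<alpha>' \<beta>' j] ab ba assms(3)[OF that] that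
    by (intro divide_pos_pos) auto
  then obtain w v where w: "0 < w" "w < 1/2" and v: "\<And>j. j \<in> {1..m} \<Longrightarrow> 0 < v j \<and> v j < w"
    and B0: "0 < measure lborel (B\<^sub>0 m (\<lambda>j. stacked_box m j w :: ((real ^ 'k) \<times> real) set))"
    and vol: "\<And>j. j \<in> {1..m} \<Longrightarrow> measure lborel (stacked_box m j (v j) :: ((real ^ 'k) \<times> real) set)
       = ?c j / \<alpha>' j * measure lborel (B\<^sub>0 m (\<lambda>j. stacked_box m j w :: ((real ^ 'k) \<times> real) set))"
    using stacked_boxes_with_volume_ratios[OF assms(1), of "\<lambda>j. ?c j / \<alpha>' j", where 'k = 'k] by blast
  define F where "F j = (stacked_box m j w :: ((real ^ 'k) \<times> real) set)" for j
  define B where "B j = (stacked_box m j (v j) :: ((real ^ 'k) \<times> real) set)" for j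
  define h where "h j = (w - v j) / real m" for j
  define \<eta> where "\<eta> j = root CARD('k) (\<alpha>' j * (h j * measure lborel (B j)) / measure lborel (D j))" for j
  have adm: "admissible_resonators m F B
      (\<lambda>j. (vec (1/2), (real j - 1/2 + (w + v j) / 2) / real m)) h v"
    unfolding F_def B_def h_def by (rule admissible_stacked_boxes[OF assms(1) w v])
  have pos: "0 < h j" "0 < measure lborel (B j)" "0 < measure lborel (D j)" "0 < \<alpha>' j"
    if j: "j \<in> {1..m}" for j
  proof -
    show "0 < h j" using v[OF j] assms(1) by (simp add: h_def)
    show "0 < measure lborel (B j)"
      unfolding B_def using assms(1) v[OF j] by (simp add: measure_stacked_box)
    show "0 < measure lborel (D j)"
      using assms(2)[OF j] by (intro measure_lborel_open_pos) (auto simp: lipschitz_domain_def)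
    show "0 < \<alpha>' j" using assms(3)[OF j] by blast
  qed
  have \<eta>: "0 < \<eta> j" if "j \<in> {1..m}" for j
    using pos[OF that] by (simp add: \<eta>_def)
  have alpha: "alpha D B \<eta> h j = \<alpha>' j" if "j \<in> {1..m}" for j
  proof -
    have "\<eta> j ^ CARD('k) = \<alpha>' j * (h j * measure lborel (B j)) / measure lborel (D j)"
      unfolding \<eta>_def using pos[OF that] by (intro real_root_pow_pos2) auto
    then show ?thesis using pos[OF that] by (simp add: alpha_def)
  qed
  have "is_beta m (alpha D B \<eta> h) F B \<beta>'"
  proof (rule is_beta_of_interlacing)
    fix j assume j: "j \<in> {1..m}"
    have "\<alpha>' j * measure lborel (B j) = measure lborel (B\<^sub>0 m F) * ?c j"
      using vol[OF j] pos(4)[OF j] unfolding B_def F_def by simp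
    moreover have "(\<Prod>i\<in>{1..m} - {j}. (\<beta>' i - alpha D B \<eta> h j) / (alpha D B \<eta> h i - alpha D B \<eta> h j))
        = (\<Prod>i\<in>{1..m} - {j}. (\<beta>' i - \<alpha>' j) / (\<alpha>' i - \<alpha>' j))"
      using j by (intro prod.cong refl) (simp add: alpha)
    ultimately show "alpha D B \<eta> h j * measure lborel (B j) = measure lborel (B\<^sub>0 m F) *
       ((\<beta>' j - alpha D B \<eta> h j) *
        (\<Prod>i\<in>{1..m} - {j}. (\<beta>' i - alpha D B \<eta> h j) / (alpha D B \<eta> h i - alpha D B \<eta> h j)))"
      by (simp only: alpha[OF j])
  next
    have F: "F = (\<lambda>j. stacked_box m j w)" by (simp add: F_def fun_eq_iff)
    show "measure lborel (B\<^sub>0 m F) \<noteq> 0" unfolding F using B0 by simp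
  qed (use ab ba alpha in auto)
  moreover have "strict_mono_on {1..m} (alpha D B \<eta> h)"
  proof (rule strict_mono_onI)
    fix i j assume "i \<in> {1..m}" "j \<in> {1..m}" "i < j"
    then show "alpha D B \<eta> h i < alpha D B \<eta> h j" using ab[of i] ba[of i j] by (simp add: alpha)
  qed
  ultimately show ?thesis using adm \<eta> alpha by blast
qed

end
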